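(* For every positive integer $n$ and every real $r_0>0$ there exists a constant $\delta=\delta(n,r_0)>0$, depending only on $n$ and $r_0$, with the following property. Let $p\ge1$ and let $A^\alpha$, $\alpha=1,\dots,p$, be real symmetric $n\times n$ matrices. Put $$S=\sum_{\alpha=1}^p|A^\alpha|^2,\qquad H^\alpha=\operatorname{tr}A^\alpha,\qquad R=\sum_{\alpha=1}^p(H^\alpha)^2-S,$$ and assume that $S\le 1$ and $R\ge r_0$. Then $$\sum_{\alpha=1}^p (A^\alpha)^2\le (1-\delta)I.$$
   Context: $|A|^2=\sum_{i,j}a_{ij}^2$ is the squared Frobenius norm of a matrix $A=(a_{ij})$; $(A^\alpha)^2$ is the matrix square; $I$ is the $n\times n$ identity matrix; the superscript $\alpha$ is an index, not a power. For symmetric matrices, $P\le Q$ means that $Q-P$ is positive semidefinite. *)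

theory Defs
  imports "HOL-Analysis.Analysis"
begin

definition sym_matrix :: "real ^ 'n ^ 'n \<Rightarrow> bool" where
  "sym_matrix M \<longleftrightarrow> transpose M = M"

definition frobenius_sq :: "real ^ 'n ^ 'm \<Rightarrow> real" where
  "frobenius_sq M = (\<Sum>i\<in>UNIV. \<Sum>j\<in>UNIV. (M $ i $ j)\<^sup>2)"

definition pos_semidef :: "real ^ 'n ^ 'n \<Rightarrow> bool" where
  "pos_semidef M \<longleftrightarrow> sym_matrix M \<and> (\<forall>x. 0 \<le> x \<bullet> (M *v x))"

(* The library order on vectors, hence on matrices, is componentwise,
   so the Loewner order needs its own relation. *)
definition loewner_le :: "real ^ 'n ^ 'n \<Rightarrow> real ^ 'n ^ 'n \<Rightarrow> bool"  (infix "\<preceq>\<^sub>L" 50) where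
  "P \<preceq>\<^sub>L Q \<longleftrightarrow> pos_semidef (Q - P)"

end

theory Submission
  imports Defs
begin

text \<open>
  For a unit vector \<open>v\<close>, the matrix \<open>A - (A v) v\<^sup>T\<close> has trace \<open>tr A - \<langle>v, A v\<rangle>\<close> and squared Frobenius
  norm \<open>|A|\<^sup>2 - |A v|\<^sup>2\<close>, so Cauchy--Schwarz gives \<open>(tr A - \<langle>v, A v\<rangle>)\<^sup>2 \<le> n (|A|\<^sup>2 - |A v|\<^sup>2)\<close>. Hence, if
  \<open>\<Sum> |A\<^sup>\<alpha> v|\<^sup>2\<close> were close to \<open>1 \<ge> S\<close>, then \<open>\<Sum> (tr A\<^sup>\<alpha>)\<^sup>2\<close> would be close to \<open>\<Sum> \<langle>v, A\<^sup>\<alpha> v\<rangle>\<^sup>2 \<le> S\<close>,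
  which makes \<open>R\<close> small.
\<close>

lemma frobenius_sq_eq_inner: "frobenius_sq M = M \<bullet> M"
  by (simp add: frobenius_sq_def inner_vec_def power2_eq_square)

lemma trace_eq_inner: "trace (M :: real ^ 'n ^ 'n) = M \<bullet> mat 1"
  by (simp add: trace_def inner_vec_def mat_def if_distrib cong: if_cong)

lemma trace_sq_le:
  fixes M :: "real ^ 'n ^ 'n"
  shows "(trace M)\<^sup>2 \<le> real CARD('n) * frobenius_sq M"
proof -
  have "(mat 1 :: real ^ 'n ^ 'n) \<bullet> mat 1 = real CARD('n)"
    unfolding trace_eq_inner[symmetric] by (simp add: trace_def mat_def)
  then show ?thesis
    using Cauchy_Schwarz_ineq[of M "mat 1"]
    by (simp add: trace_eq_inner frobenius_sq_eq_inner mult.commute)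
qed

lemma
  fixes A :: "real ^ 'n ^ 'n" and v :: "real ^ 'n"
  assumes "norm v = 1"
  shows trace_minus_quadratic_form_sq_le:
      "(trace A - v \<bullet> (A *v v))\<^sup>2 \<le> real CARD('n) * (frobenius_sq A - (norm (A *v v))\<^sup>2)"
    and norm_mult_sq_le_frobenius_sq: "(norm (A *v v))\<^sup>2 \<le> frobenius_sq A"
proof -
  \<comment> \<open>\<open>N\<close> is the Frobenius-orthogonal projection of \<open>A\<close> onto
    the matrices of the form w v^T. This is why \<open>A \<bullet> N\<close> and
    \<open>N \<bullet> N\<close> agree, and Pythagoras then gives the norm of
    \<open>A - N\<close>.\<close>
  define N :: "real ^ 'n ^ 'n" where "N = (\<chi> i j. (A *v v) $ i * v $ j)"
  have AN: "A \<bullet> N = (A *v v) \<bullet> (A *v v)"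
    unfolding inner_vec_def N_def
    by (simp add: matrix_vector_mult_def sum_distrib_left sum_distrib_right mult_ac)
  have "N \<bullet> N = ((A *v v) \<bullet> (A *v v)) * (v \<bullet> v)"
    unfolding inner_vec_def N_def
    by (subst sum.swap) (simp add: sum_product mult_ac)
  then have NN: "N \<bullet> N = (A *v v) \<bullet> (A *v v)"
    using assms by (simp add: norm_eq_1)
  have "trace N = v \<bullet> (A *v v)"
    by (simp add: trace_def N_def inner_vec_def mult.commute)
  then have tr: "trace (A - N) = trace A - v \<bullet> (A *v v)"
    by (simp add: trace_sub)
  have fr: "frobenius_sq (A - N) = frobenius_sq A - (norm (A *v v))\<^sup>2"
    using AN NN
    by (simp add: frobenius_sq_eq_inner inner_diff inner_commute power2_norm_eq_inner)
  show "(trace A - v \<bullet> (A *v v))\<^sup>2 \<le> real CARD('n) * (frobenius_sq A - (norm (A *v v))\<^sup>2)"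
    using trace_sq_le[of "A - N"] unfolding tr fr .
  have "0 \<le> frobenius_sq (A - N)"
    by (simp add: frobenius_sq_eq_inner)
  then show "(norm (A *v v))\<^sup>2 \<le> frobenius_sq A"
    unfolding fr by simp
qed

text \<open>Young's inequality with a weight: the factor of \<open>a\<^sup>2\<close> can be kept
  near 1 at the price of a large factor on \<open>b\<^sup>2\<close>. Below, \<open>a\<close> is the
  quadratic form at \<open>v\<close> and \<open>b\<close> is the rest of the trace, which is small
  when |A v| nearly exhausts |A|.\<close>

lemma square_add_le:
  fixes a b e :: real
  assumes "e > 0"
  shows "(a + b)\<^sup>2 \<le> (1 + e) * a\<^sup>2 + (1 + 1 / e) * b\<^sup>2"
proof -
  have "0 \<le> (e * a - b)\<^sup>2 / e"
    using assms by simp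
  also have "\<dots> = (1 + e) * a\<^sup>2 + (1 + 1 / e) * b\<^sup>2 - (a + b)\<^sup>2"
    using assms by (simp add: field_simps power2_eq_square)
  finally show ?thesis by simp
qed

text \<open>Split the trace as \<open>a + b\<close> with \<open>a\<close> the quadratic form at
  \<open>v\<close>, so that \<open>a\<^sup>2\<close> is at most |A v|^2 \<le> |A|^2. The bound is
  linear in |A|^2 and |A v|^2, with coefficients independent of \<open>A\<close>, so it can be
  summed over \<alpha> directly.\<close>

lemma trace_sq_minus_frobenius_sq_le:
  fixes A :: "real ^ 'n ^ 'n"
  assumes "norm v = 1" and "e > 0"
  shows "(trace A)\<^sup>2 - frobenius_sq A
    \<le> e * frobenius_sq A + (1 + 1 / e) * real CARD('n) * (frobenius_sq A - (norm (A *v v))\<^sup>2)"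
proof -
  define a b where "a = v \<bullet> (A *v v)" and "b = trace A - a"
  have "\<bar>a\<bar> \<le> norm (A *v v)"
    using Cauchy_Schwarz_ineq2[of v "A *v v"] assms(1) by (simp add: a_def)
  then have "a\<^sup>2 \<le> (norm (A *v v))\<^sup>2"
    using abs_le_square_iff by fastforce
  then have "a\<^sup>2 \<le> frobenius_sq A"
    using norm_mult_sq_le_frobenius_sq[OF assms(1)] by (rule order_trans)
  then have "(1 + e) * a\<^sup>2 \<le> (1 + e) * frobenius_sq A"
    using assms(2) by (intro mult_left_mono) auto
  moreover have "(1 + 1 / e) * b\<^sup>2
      \<le> (1 + 1 / e) * (real CARD('n) * (frobenius_sq A - (norm (A *v v))\<^sup>2))"
    using trace_minus_quadratic_form_sq_le[OF assms(1)] assms(2)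
    by (intro mult_left_mono) (auto simp: a_def b_def)
  moreover have "(trace A)\<^sup>2 \<le> (1 + e) * a\<^sup>2 + (1 + 1 / e) * b\<^sup>2"
    using square_add_le[OF assms(2), of a b] by (simp add: b_def)
  ultimately show ?thesis
    by (simp add: algebra_simps)
qed

lemma sum_norm_mult_sq_le:
  fixes A :: "'i \<Rightarrow> real ^ 'n ^ 'n"
  assumes "r > 0" and S: "(\<Sum>\<alpha>\<in>I. frobenius_sq (A \<alpha>)) \<le> 1"
    and R: "r \<le> (\<Sum>\<alpha>\<in>I. (trace (A \<alpha>))\<^sup>2) - (\<Sum>\<alpha>\<in>I. frobenius_sq (A \<alpha>))"
  shows "(\<Sum>\<alpha>\<in>I. (norm (A \<alpha> *v x))\<^sup>2)
    \<le> (1 - r / 2 / ((1 + 2 / r) * real CARD('n))) * (norm x)\<^sup>2"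
proof (cases "x = 0")
  case True
  then show ?thesis by simp
next
  case False
  \<comment> \<open>Both sides are homogeneous of degree 2 in \<open>x\<close>, so the unit vector
    \<open>v\<close> suffices.\<close>
  define v where "v = x /\<^sub>R norm x"
  have v: "norm v = 1"
    using False by (simp add: v_def)
  define c where "c = (1 + 2 / r) * real CARD('n)"
  have "c > 0"
    using assms(1) by (auto simp: c_def intro!: mult_pos_pos add_pos_pos)
  define S' Q where "S' = (\<Sum>\<alpha>\<in>I. frobenius_sq (A \<alpha>))"
    and "Q = (\<Sum>\<alpha>\<in>I. (norm (A \<alpha> *v v))\<^sup>2)"
  have "r \<le> (\<Sum>\<alpha>\<in>I. (trace (A \<alpha>))\<^sup>2 - frobenius_sq (A \<alpha>))"
    using R by (simp add: sum_subtractf)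
  \<comment> \<open>The choice \<open>e = r / 2\<close> makes the first term cost at most half of
    the lower bound \<open>r\<close>, since the total squared norm is at most 1; the other half has
    to come from the defect \<open>S' - Q\<close>.\<close>
  also have "\<dots> \<le> (\<Sum>\<alpha>\<in>I. r / 2 * frobenius_sq (A \<alpha>)
      + c * (frobenius_sq (A \<alpha>) - (norm (A \<alpha> *v v))\<^sup>2))"
    using trace_sq_minus_frobenius_sq_le[OF v, of "r / 2"] assms(1)
    by (intro sum_mono) (simp add: c_def)
  also have "\<dots> = r / 2 * S' + c * (S' - Q)"
    unfolding S'_def Q_def sum.distrib sum_distrib_left[symmetric] sum_subtractf ..
  \<comment> \<open>The expression is increasing in \<open>S'\<close>, so \<open>S'\<close> may be
    replaced by its upper bound 1.\<close>
  also have "\<dots> \<le> r / 2 * 1 + c * (1 - Q)"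
    using S \<open>c > 0\<close> assms(1) unfolding S'_def[symmetric]
    by (intro add_mono mult_left_mono) auto
  finally have "r / 2 / c \<le> 1 - Q"
    using \<open>c > 0\<close> by (simp add: field_simps)
  then have "Q * (norm x)\<^sup>2 \<le> (1 - r / 2 / c) * (norm x)\<^sup>2"
    by (intro mult_right_mono) auto
  moreover have "x = norm x *\<^sub>R v"
    using False by (simp add: v_def)
  then have "norm (A \<alpha> *v x) = norm x * norm (A \<alpha> *v v)" for \<alpha>
    by (metis abs_norm_cancel norm_scaleR matrix_vector_mult_scaleR)
  then have "(\<Sum>\<alpha>\<in>I. (norm (A \<alpha> *v x))\<^sup>2) = Q * (norm x)\<^sup>2"
    by (simp add: Q_def power_mult_distrib mult.commute flip: sum_distrib_left)
  ultimately show ?thesis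
    by (simp add: c_def)
qed

lemma sum_matrix_vector_mult:
  fixes B :: "'i \<Rightarrow> real ^ 'n ^ 'm"
  shows "(\<Sum>\<alpha>\<in>I. B \<alpha>) *v x = (\<Sum>\<alpha>\<in>I. B \<alpha> *v x)"
  by (induction I rule: infinite_finite_induct) (simp_all add: matrix_vector_mult_add_rdistrib)

text \<open>For symmetric A the quadratic form of A^2 at x is |A x|^2, so the assumed bound is
  exactly the Loewner inequality tested on vectors.\<close>

lemma sum_squares_loewner_le:
  fixes A :: "'i \<Rightarrow> real ^ 'n ^ 'n"
  assumes sym: "\<And>\<alpha>. \<alpha> \<in> I \<Longrightarrow> sym_matrix (A \<alpha>)"
    and le: "\<And>x. (\<Sum>\<alpha>\<in>I. (norm (A \<alpha> *v x))\<^sup>2) \<le> c * (norm x)\<^sup>2"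
  shows "(\<Sum>\<alpha>\<in>I. A \<alpha> ** A \<alpha>) \<preceq>\<^sub>L c *\<^sub>R mat 1"
  unfolding loewner_le_def pos_semidef_def
proof (intro conjI allI)
  have "transpose (\<Sum>\<alpha>\<in>I. A \<alpha> ** A \<alpha>) = (\<Sum>\<alpha>\<in>I. transpose (A \<alpha> ** A \<alpha>))"
    by (simp add: transpose_def vec_eq_iff)
  also have "\<dots> = (\<Sum>\<alpha>\<in>I. A \<alpha> ** A \<alpha>)"
    using sym by (intro sum.cong) (auto simp: sym_matrix_def matrix_transpose_mul)
  finally have "transpose (\<Sum>\<alpha>\<in>I. A \<alpha> ** A \<alpha>) = (\<Sum>\<alpha>\<in>I. A \<alpha> ** A \<alpha>)" .
  then show "sym_matrix (c *\<^sub>R mat 1 - (\<Sum>\<alpha>\<in>I. A \<alpha> ** A \<alpha>))"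
    unfolding sym_matrix_def by (simp add: transpose_def vec_eq_iff mat_def)
next
  fix x :: "real ^ 'n"
  have "x \<bullet> ((A \<alpha> ** A \<alpha>) *v x) = (norm (A \<alpha> *v x))\<^sup>2" if "\<alpha> \<in> I" for \<alpha>
    using sym[OF that]
    by (metis dot_lmul_matrix matrix_vector_mul_assoc power2_norm_eq_inner
        sym_matrix_def transpose_matrix_vector)
  then have "x \<bullet> ((\<Sum>\<alpha>\<in>I. A \<alpha> ** A \<alpha>) *v x) = (\<Sum>\<alpha>\<in>I. (norm (A \<alpha> *v x))\<^sup>2)"
    by (simp add: sum_matrix_vector_mult inner_sum_right)
  moreover have "x \<bullet> ((c *\<^sub>R mat 1) *v x) = c * (norm x)\<^sup>2"
    by (simp add: scaleR_matrix_vector_assoc[symmetric] power2_norm_eq_inner)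
  ultimately show "0 \<le> x \<bullet> ((c *\<^sub>R mat 1 - (\<Sum>\<alpha>\<in>I. A \<alpha> ** A \<alpha>)) *v x)"
    using le[of x] by (simp add: matrix_vector_mult_diff_rdistrib inner_diff_right)
qed

theorem lemma5:
  fixes r0 :: real
  assumes "r0 > 0"
  shows "\<exists>\<delta>>0. \<forall>(p :: nat) (A :: nat \<Rightarrow> real ^ 'n ^ 'n).
           p \<ge> 1 \<longrightarrow> (\<forall>\<alpha>\<in>{1..p}. sym_matrix (A \<alpha>)) \<longrightarrow>
           (let S = (\<Sum>\<alpha>=1..p. frobenius_sq (A \<alpha>));
                H = (\<lambda>\<alpha>. trace (A \<alpha>));
                R = (\<Sum>\<alpha>=1..p. (H \<alpha>)\<^sup>2) - S
            in S \<le> 1 \<longrightarrow> R \<ge> r0 \<longrightarrow>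
               (\<Sum>\<alpha>=1..p. A \<alpha> ** A \<alpha>) \<preceq>\<^sub>L (1 - \<delta>) *\<^sub>R mat 1)"
proof (intro exI conjI)
  \<comment> \<open>This is the gap from \<open>sum_norm_mult_sq_le\<close> at
    \<open>r = r0\<close>; it involves only \<open>r0\<close> and the dimension, hence is uniform in
    \<open>p\<close> and \<open>A\<close>.\<close>
  let ?\<delta> = "r0 / 2 / ((1 + 2 / r0) * real CARD('n))"
  show "?\<delta> > 0"
    using assms by (intro divide_pos_pos mult_pos_pos add_pos_pos) auto
  show "\<forall>(p :: nat) (A :: nat \<Rightarrow> real ^ 'n ^ 'n).
           p \<ge> 1 \<longrightarrow> (\<forall>\<alpha>\<in>{1..p}. sym_matrix (A \<alpha>)) \<longrightarrow>
           (let S = (\<Sum>\<alpha>=1..p. frobenius_sq (A \<alpha>));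
                H = (\<lambda>\<alpha>. trace (A \<alpha>));
                R = (\<Sum>\<alpha>=1..p. (H \<alpha>)\<^sup>2) - S
            in S \<le> 1 \<longrightarrow> R \<ge> r0 \<longrightarrow>
               (\<Sum>\<alpha>=1..p. A \<alpha> ** A \<alpha>) \<preceq>\<^sub>L (1 - ?\<delta>) *\<^sub>R mat 1)"
    unfolding Let_def
    by (intro allI impI sum_squares_loewner_le sum_norm_mult_sq_le assms) auto
qed

end
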